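(* Let $a,b,c,d \geq 0$ with $\{a,b\} \neq \{c,d\}$. Then the pattern sets $[1342,\sigma(0^{a+1}1^b)]$ and $[1342,\sigma(0^{c+1}1^d)]$ are not Wilf equivalent.
   Context: For a binary word $w=w_1\cdots w_{n-1}$, $\sigma(w)=\sigma_1\cdots\sigma_n$ is the permutation of $[n]$ where, for $k=1,\dots,n-1$, $\sigma_k$ is the minimum of the unused values of $[n]$ if $w_k=0$ and the maximum if $w_k=1$, and $\sigma_n$ is the remaining value. A circular permutation $[\pi]$ of size $n$ is the set of all rotations of a permutation $\pi$ of $[n]$; $[\sigma]$ contains $[\pi]$ if some rotation of $\sigma$ has a subsequence order-isomorphic to $\pi$, otherwise avoids it. $\mathrm{Av}_n[\pi_1,\dots,\pi_m]$ is the set of circular permutations of size $n$ avoiding each $[\pi_i]$; two pattern sets are Wilf equivalent if their $\mathrm{Av}_n$ have equal cardinality for every $n\ge 1$. *)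

theory Defs
  imports "HOL-Library.Sublist" "HOL-Combinatorics.Multiset_Permutations"
begin

text \<open>
  Permutations of \<open>[n] = {1..n}\<close> are written in one-line notation, as the elements of
  \<^term>\<open>permutations_of_set {1..n::nat}\<close>. In binary words \<^term>\<open>False\<close> is the letter 0 and
  \<^term>\<open>True\<close> the letter 1.
\<close>

text \<open>The first argument is the set of values not yet used.\<close>

fun sigma_from :: "nat set \<Rightarrow> bool list \<Rightarrow> nat list" where
  "sigma_from U [] = [the_elem U]"
| "sigma_from U (b # w) =
     (let v = (if b then Max U else Min U) in v # sigma_from (U - {v}) w)"

definition sigma :: "bool list \<Rightarrow> nat list" where
  "sigma w = sigma_from {1..length w + 1} w"

definition circ :: "nat list \<Rightarrow> nat list set" where
  "circ xs = {rotate k xs | k. True}"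

definition circ_perms :: "nat \<Rightarrow> nat list set set" where
  "circ_perms n = circ ` permutations_of_set {1..n}"

definition order_iso :: "nat list \<Rightarrow> nat list \<Rightarrow> bool" where
  "order_iso xs ys \<longleftrightarrow> length xs = length ys \<and>
     (\<forall>i < length xs. \<forall>j < length xs. xs ! i < xs ! j \<longleftrightarrow> ys ! i < ys ! j)"

text \<open>
  \<open>C\<close> is a circular permutation and \<open>p\<close> a linear representative of the circular pattern
  \<open>[p]\<close>; since \<open>C\<close> is closed under rotation, the choice of representative does not matter.
\<close>

definition circ_contains :: "nat list set \<Rightarrow> nat list \<Rightarrow> bool" where
  "circ_contains C p \<longleftrightarrow> (\<exists>s\<in>C. \<exists>xs. subseq xs s \<and> order_iso xs p)"

text \<open>A pattern set is given by linear representatives of its circular patterns.\<close>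

definition Av :: "nat \<Rightarrow> nat list set \<Rightarrow> nat list set set" where
  "Av n P = {C \<in> circ_perms n. \<forall>p\<in>P. \<not> circ_contains C p}"

definition wilf_equivalent :: "nat list set \<Rightarrow> nat list set \<Rightarrow> bool" where
  "wilf_equivalent P Q \<longleftrightarrow> (\<forall>n\<ge>1. card (Av n P) = card (Av n Q))"

end

theory Submission
  imports Defs
begin

text \<open>
  A circular permutation avoids \<open>[1342]\<close> iff it is \<open>[\<sigma>(w)]\<close> for some binary word \<open>w\<close>. If
  \<open>a + b < c + d\<close>, the two avoidance classes already differ in size \<open>a + b + 2\<close>. If
  \<open>a + b = c + d\<close>, the maxima of \<open>{a, b}\<close> and \<open>{c, d}\<close> differ, and the rates of growth
  distinguish them: \<open>[\<sigma>(w)]\<close> avoids \<open>[\<sigma>(0\<^sup>a\<^sup>+\<^sup>11\<^sup>b)]\<close> as soon as \<open>w\<close> has fewer than \<open>b\<close> ones or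
  fewer than \<open>a\<close> zeros, whereas avoidance forces \<open>w\<close>, apart from a prefix of bounded length, to
  be of this form. So for large \<open>n\<close> the number of avoiders is of order \<open>n\<close> to the power
  \<open>max a b - 1\<close>.
\<close>

section \<open>Lists in which every entry is extremal among the later ones\<close>

text \<open>Letting the direction of comparison be a letter allows the minimum and maximum cases to
  share their proofs.\<close>

definition lt :: "bool \<Rightarrow> nat \<Rightarrow> nat \<Rightarrow> bool" where
  "lt b x y \<longleftrightarrow> (if b then y < x else x < y)"

text \<open>\<open>enc w s\<close> says that \<open>s\<close> has the order type of
  \<open>sigma w\<close>, with no condition on the values. Unlike \<open>sigma\<close>, it therefore
  survives passing to subsequences. The last entry carries no letter.\<close>

fun enc :: "bool list \<Rightarrow> nat list \<Rightarrow> bool" where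
  "enc [] xs \<longleftrightarrow> (\<exists>x. xs = [x])"
| "enc (b # w) [] \<longleftrightarrow> False"
| "enc (b # w) (x # xs) \<longleftrightarrow> (\<forall>y\<in>set xs. lt b x y) \<and> enc w xs"

fun word :: "nat list \<Rightarrow> bool list" where
  "word (x # y # xs) = (y < x) # word (y # xs)"
| "word xs = []"

lemma enc_length: "enc w s \<Longrightarrow> length s = Suc (length w)"
  by (induction w s rule: enc.induct) auto

lemma enc_nonempty: "enc w s \<Longrightarrow> s \<noteq> []"
  by (cases w; cases s) auto

lemma enc_distinct: "enc w s \<Longrightarrow> distinct s"
  by (induction w s rule: enc.induct) (auto simp: lt_def split: if_splits)

text \<open>An entry extremal among all later ones reveals its direction already against its
  immediate successor.\<close>

lemma enc_word: "enc w s \<Longrightarrow> word s = w"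
proof (induction w s rule: enc.induct)
  case (3 b w x xs)
  then obtain y ys where "xs = y # ys"
    using enc_nonempty by (metis enc.simps(3) neq_Nil_conv)
  with 3 show ?case by (auto simp: lt_def split: if_splits)
qed auto

lemma enc_append:
  assumes "sorted_wrt (lt b) xs" "\<And>x y. x \<in> set xs \<Longrightarrow> y \<in> set ys \<Longrightarrow> lt b x y" "enc w ys"
  shows "enc (replicate (length xs) b @ w) (xs @ ys)"
  using assms by (induction xs) auto

lemma enc_sigma_from:
  assumes "finite U" "card U = Suc (length w)"
  shows "enc w (sigma_from U w) \<and> set (sigma_from U w) = U"
  using assms
proof (induction w arbitrary: U)
  case Nil
  then obtain x where "U = {x}" by (metis card_1_singletonE list.size(3) One_nat_def)
  then show ?case by simp
next
  case (Cons b w)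
  define v where "v = (if b then Max U else Min U)"
  have ne: "U \<noteq> {}" using Cons.prems by auto
  have vU: "v \<in> U" using Cons.prems ne by (auto simp: v_def)
  have "card (U - {v}) = Suc (length w)" using Cons.prems vU by simp
  then have IH: "enc w (sigma_from (U - {v}) w)" "set (sigma_from (U - {v}) w) = U - {v}"
    using Cons by auto
  have "lt b v y" if "y \<in> U - {v}" for y
  proof (cases b)
    case True
    with that Cons.prems have "y \<le> v" by (simp add: v_def)
    with that True show ?thesis by (auto simp: lt_def)
  next
    case False
    with that Cons.prems have "v \<le> y" by (simp add: v_def)
    with that False show ?thesis by (auto simp: lt_def)
  qed
  then show ?case using IH vU by (auto simp: Let_def v_def[symmetric])
qed

lemma enc_sigma: "enc w (sigma w)" and set_sigma: "set (sigma w) = {1..length w + 1}"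
  unfolding sigma_def using enc_sigma_from[of "{1..length w + 1}" w] by auto

text \<open>The first letter forces the head to be the minimum or maximum of the common entry set;
  induction handles the rest.\<close>

lemma enc_unique:
  assumes "enc w s" "enc w t" "set s = set t"
  shows "s = t"
  using assms
proof (induction w s arbitrary: t rule: enc.induct)
  case (1 xs)
  then show ?case by auto
next
  case (3 b w x xs)
  note set_eq = \<open>set (x # xs) = set t\<close>
  from \<open>enc (b # w) t\<close> obtain y ys where t: "t = y # ys" by (cases t) auto
  have e: "\<forall>z\<in>set xs. lt b x z" "enc w xs" "\<forall>z\<in>set ys. lt b y z" "enc w ys"
    using \<open>enc (b # w) (x # xs)\<close> \<open>enc (b # w) t\<close> by (simp_all add: t)
  have d: "x \<notin> set xs" "y \<notin> set ys"
    using enc_distinct[OF \<open>enc (b # w) (x # xs)\<close>] enc_distinct[OF \<open>enc (b # w) t\<close>] by (simp_all add: t)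
  have "x = y"
  proof (rule ccontr)
    assume "x \<noteq> y"
    then have "y \<in> set xs" "x \<in> set ys"
      using set_eq unfolding t by (metis list.set_intros(1) set_ConsD)+
    then have "lt b x y" "lt b y x" using e by blast+
    then show False by (simp add: lt_def split: if_splits)
  qed
  moreover have "set xs = set ys" using set_eq d unfolding t \<open>x = y\<close> by (simp add: insert_ident)
  then have "xs = ys" using \<open>enc w ys\<close> "3.IH"[of ys] e by blast
  ultimately show ?case by (simp add: t)
qed simp

lemma subseq_imp_subset: "subseq xs ys \<Longrightarrow> set xs \<subseteq> set ys"
  by (induction rule: list_emb.induct) auto

text \<open>Extremality among the later entries is inherited when later entries are deleted. With
  \<open>enc_subseq_list\<close>, this turns pattern containment between encoded lists into the
  subword relation.\<close>

lemma enc_subseq_word: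
  assumes "enc w s" "subseq u w"
  shows "\<exists>xs. subseq xs s \<and> enc u xs"
  using assms
proof (induction w s arbitrary: u rule: enc.induct)
  case (1 xs)
  then show ?case by (cases u) auto
next
  case (3 b w x xs)
  show ?case
  proof (cases u)
    case Nil
    then show ?thesis by (intro exI[of _ "[x]"]) auto
  next
    case (Cons b' u')
    show ?thesis
    proof (cases "b' = b \<and> subseq u' w")
      case True
      then obtain ys where "subseq ys xs" "enc u' ys" using 3 by auto
      moreover have "\<forall>y\<in>set ys. lt b x y"
        using \<open>subseq ys xs\<close> 3(2) subseq_imp_subset[of ys xs] by auto
      ultimately show ?thesis using True Cons by (intro exI[of _ "x # ys"]) simp
    next
      case False
      with 3(3) Cons have "subseq u w" by (auto split: if_splits)
      then obtain ys where "subseq ys xs" "enc u ys" using 3 by auto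
      then show ?thesis by (intro exI[of _ ys]) auto
    qed
  qed
qed simp

lemma enc_subseq_list:
  assumes "enc w s" "subseq xs s" "xs \<noteq> []"
  shows "\<exists>u. subseq u w \<and> enc u xs"
  using assms
proof (induction w s arbitrary: xs rule: enc.induct)
  case (1 s)
  then show ?case by (cases xs) (auto simp: subseq_Cons' split: if_splits intro: exI[of _ "[]"])
next
  case (3 b w x s)
  then obtain y ys where xs: "xs = y # ys" by (cases xs) auto
  show ?case
  proof (cases "y = x \<and> subseq ys s \<and> ys \<noteq> []")
    case True
    then obtain u where "subseq u w" "enc u ys" using 3 by auto
    moreover have "\<forall>y\<in>set ys. lt b x y" using True 3(2) subseq_imp_subset[of ys s] by auto
    ultimately show ?thesis using True xs by (intro exI[of _ "b # u"]) simp
  next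
    case False
    show ?thesis
    proof (cases "ys = []")
      case True
      with xs show ?thesis by (intro exI[of _ "[]"]) auto
    next
      case ne: False
      with False 3(3) xs have "subseq xs s" by (auto split: if_splits)
      with 3 obtain u where "subseq u w" "enc u xs" by auto
      then show ?thesis by (intro exI[of _ u]) auto
    qed
  qed
qed simp

section \<open>Order isomorphism and rotation\<close>

lemma order_iso_length: "order_iso xs ys \<Longrightarrow> length xs = length ys"
  unfolding order_iso_def by (rule conjunct1)

text \<open>Phrased through the set of aligned pairs, the condition no longer mentions positions, so
  rotating both lists alike preserves it.\<close>

lemma order_iso_zip:
  "order_iso xs ys \<longleftrightarrow> length xs = length ys \<and>
     (\<forall>(x, y)\<in>set (zip xs ys). \<forall>(x', y')\<in>set (zip xs ys). x < x' \<longleftrightarrow> y < y')"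
  unfolding order_iso_def set_zip by fastforce

lemma order_iso_rotate:
  assumes "order_iso (us @ vs) (P @ Q)" "length us = length P"
  shows "order_iso (vs @ us) (Q @ P)"
  using assms unfolding order_iso_zip by (simp add: Un_commute)

lemma order_iso_lt:
  assumes "order_iso xs ys" "(x, y) \<in> set (zip xs ys)" "(x', y') \<in> set (zip xs ys)"
  shows "lt b x x' \<longleftrightarrow> lt b y y'"
proof -
  have "x < x' \<longleftrightarrow> y < y'" "x' < x \<longleftrightarrow> y' < y" using assms unfolding order_iso_zip by blast+
  then show ?thesis by (simp add: lt_def)
qed

lemma order_iso_ConsD: "order_iso (x # xs) (y # ys) \<Longrightarrow> order_iso xs ys"
  by (fastforce simp: order_iso_zip)

lemma enc_order_iso:
  assumes "order_iso xs ys" "enc w xs"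
  shows "enc w ys"
  using assms
proof (induction w xs arbitrary: ys rule: enc.induct)
  case (1 xs)
  then have "length ys = Suc 0" using order_iso_length by fastforce
  then show ?case by (auto simp: length_Suc_conv)
next
  case (3 b w x xs)
  then obtain y zs where ys: "ys = y # zs" by (cases ys) (auto dest: order_iso_length)
  have iso: "order_iso xs zs" using 3 ys order_iso_ConsD by auto
  have "lt b y z" if "z \<in> set zs" for z
  proof -
    have "length xs = length zs" using iso by (rule order_iso_length)
    with that obtain x' where x': "(x', z) \<in> set (zip xs zs)"
      by (metis in_set_impl_in_set_zip2)
    then have "lt b x x'" using 3 by (auto dest: set_zip_leftD)
    then show ?thesis using order_iso_lt[OF 3(2), of x y x' z b] ys x' by auto
  qed
  then show ?case using 3 iso ys by auto
qed simp

text \<open>Any two entries compare as the letter of the earlier one dictates, so the word fixes the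
  order type.\<close>

lemma enc_imp_order_iso:
  assumes "enc w xs" "enc w ys"
  shows "order_iso xs ys"
  using assms
proof (induction w xs arbitrary: ys rule: enc.induct)
  case (1 xs)
  then show ?case by (auto simp: order_iso_def)
next
  case (3 b w x xs)
  then obtain y zs where ys: "ys = y # zs" by (cases ys) auto
  have iso: "order_iso xs zs" using 3 ys by auto
  have 1: "lt b x x'" "lt b y z" if "(x', z) \<in> set (zip xs zs)" for x' z
    using 3 ys that by (auto dest: set_zip_leftD set_zip_rightD)
  then have 2: "x < x' \<longleftrightarrow> y < z" "x' < x \<longleftrightarrow> z < y" if "(x', z) \<in> set (zip xs zs)" for x' z
    using 1[OF that] by (auto simp: lt_def split: if_splits)
  show ?case using iso 2 unfolding order_iso_zip ys by auto
qed simp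

section \<open>Rotations and circular containment\<close>

lemma self_in_circ: "s \<in> circ s"
  unfolding circ_def by (auto intro: exI[of _ 0])

lemma circ_append: "ys @ xs \<in> circ (xs @ ys)"
  unfolding circ_def by (auto intro!: exI[of _ "length xs"] simp: rotate_append)

lemma circ_mono: "t \<in> circ s \<Longrightarrow> circ t \<subseteq> circ s"
  unfolding circ_def by (auto simp: rotate_rotate)

lemma circ_commute: "circ (xs @ ys) = circ (ys @ xs)"
  using circ_mono[OF circ_append] by blast

lemma circE:
  assumes "t \<in> circ s"
  obtains xs ys where "s = xs @ ys" "t = ys @ xs"
proof -
  obtain k where "t = rotate k s" using assms by (auto simp: circ_def)
  then have "t = drop (k mod length s) s @ take (k mod length s) s" by (simp add: rotate_drop_take)
  then show ?thesis using that[of "take (k mod length s) s" "drop (k mod length s) s"] by simp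
qed

lemma circ_subseq_split:
  assumes "t \<in> circ s" "subseq xs t"
  obtains us vs where "xs = us @ vs" "subseq (vs @ us) s"
proof -
  obtain a b where "s = a @ b" "t = b @ a" using assms(1) by (rule circE)
  then show ?thesis using assms(2) that by (metis list_emb_append_mono subseq_appendE)
qed

lemma subseq_rotate_circ:
  assumes "subseq (us @ vs) s"
  shows "\<exists>t\<in>circ s. subseq (vs @ us) t"
proof -
  obtain a b where "s = a @ b" "subseq us a" "subseq vs b"
    using assms by (metis list_emb_appendD)
  then show ?thesis using circ_append list_emb_append_mono by metis
qed

text \<open>Moves the rotation from the host to the pattern: an occurrence in a rotation of
  \<open>s\<close>, cut at the seam and swapped, is an occurrence in \<open>s\<close> of a rotated
  pattern, and thus comes from a subword of \<open>w\<close>.\<close>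

lemma circ_containsD:
  assumes "enc w s" "circ_contains (circ s) p" "p \<noteq> []"
  obtains P Q u where "p = P @ Q" "subseq u w" "enc u (Q @ P)"
proof -
  obtain t xs where t: "t \<in> circ s" "subseq xs t" "order_iso xs p"
    using assms(2) by (auto simp: circ_contains_def)
  obtain us vs where uv: "xs = us @ vs" "subseq (vs @ us) s"
    using circ_subseq_split[OF t(1,2)] .
  define P where "P = take (length us) p"
  define Q where "Q = drop (length us) p"
  have len: "length xs = length p" using t(3) by (rule order_iso_length)
  have "p = P @ Q" "length us = length P" using len uv by (auto simp: P_def Q_def)
  then have "order_iso (vs @ us) (Q @ P)" using t(3) uv order_iso_rotate by metis
  moreover have "vs @ us \<noteq> []" using assms(3) len uv by auto
  then obtain u where "subseq u w" "enc u (vs @ us)" using enc_subseq_list[OF assms(1) uv(2)] by blast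
  ultimately show ?thesis using that \<open>p = P @ Q\<close> enc_order_iso by blast
qed

lemma circ_containsI:
  assumes "enc w s" "subseq u w" "enc u (Q @ P)"
  shows "circ_contains (circ s) (P @ Q)"
proof -
  obtain xs where xs: "subseq xs s" "enc u xs" using enc_subseq_word assms by blast
  have iso: "order_iso xs (Q @ P)" using enc_imp_order_iso xs assms by blast
  define vs where "vs = take (length Q) xs"
  define us where "us = drop (length Q) xs"
  have len: "length xs = length Q + length P" using order_iso_length[OF iso] by simp
  have vu: "xs = vs @ us" "length vs = length Q" using len by (auto simp: us_def vs_def)
  then have "order_iso (us @ vs) (P @ Q)" using iso order_iso_rotate by metis
  moreover obtain t where "t \<in> circ s" "subseq (us @ vs) t"
    using subseq_rotate_circ xs(1) vu(1) by blast
  ultimately show ?thesis unfolding circ_contains_def by blast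
qed

section \<open>The circular permutations avoiding 1342\<close>

text \<open>In each of the rotations 1342, 3421, 4213, 2134, one of the first two entries lies
  strictly between two later ones, so none is encoded by a word.\<close>

lemma enc_avoids_1342:
  assumes "enc w s"
  shows "\<not> circ_contains (circ s) [1, 3, 4, 2]"
proof
  assume "circ_contains (circ s) [1, 3, 4, 2]"
  then obtain P Q u where *: "[1, 3, 4, 2] = P @ Q" "enc u (Q @ P)"
    using circ_containsD[OF assms] by (metis list.discI)
  then show False
    by (cases u; cases "tl u")
       (auto simp: Cons_eq_append_conv lt_def split: if_splits)
qed

text \<open>The hypothesis forbids the linear patterns 213 and 231. A head that is not extremal
  would form one of them with a smaller and a larger later entry.\<close>

lemma enc_exists:
  assumes "s \<noteq> []" "distinct s"
    "\<And>x y z. subseq [x, y, z] s \<Longrightarrow> \<not> (y < x \<and> x < z) \<and> \<not> (z < x \<and> x < y)"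
  shows "\<exists>w. enc w s"
  using assms
proof (induction s)
  case (Cons x s)
  show ?case
  proof (cases "s = []")
    case True
    then show ?thesis by (intro exI[of _ "[]"]) auto
  next
    case False
    have "\<exists>w. enc w s" using Cons False by (metis distinct.simps(2) list_emb_Cons)
    then obtain w where w: "enc w s" by blast
    have "\<exists>b. \<forall>y\<in>set s. lt b x y"
    proof (rule ccontr)
      assume "\<nexists>b. \<forall>y\<in>set s. lt b x y"
      then obtain y z where yz: "y \<in> set s" "\<not> lt True x y" "z \<in> set s" "\<not> lt False x z" by blast
      moreover have "x \<noteq> y" "x \<noteq> z" using Cons.prems(2) yz by auto
      ultimately have o: "x < y" "z < x" by (auto simp: lt_def)
      then have "y \<noteq> z" by auto
      then have "subseq [y, z] s \<or> subseq [z, y] s"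
      proof -
        obtain l r where s: "s = l @ y # r" using yz(1) by (metis split_list)
        with yz(3) \<open>y \<noteq> z\<close> consider "z \<in> set l" | "z \<in> set r" by auto
        then show ?thesis
        proof cases
          case 1
          then have "subseq ([z] @ [y]) (l @ y # r)"
            by (intro list_emb_append_mono) (auto simp: subseq_singleton_left)
          with s show ?thesis by simp
        next
          case 2
          then have "subseq ([] @ [y, z]) (l @ y # r)"
            by (intro list_emb_append_mono) (auto simp: subseq_singleton_left)
          with s show ?thesis by simp
        qed
      qed
      then show False using Cons.prems(3)[of x y z] Cons.prems(3)[of x z y] o by auto
    qed
    then obtain b where "\<forall>y\<in>set s. lt b x y" by blast
    with w show ?thesis by (intro exI[of _ "b # w"]) auto
  qed
qed simp


lemma enc_Cons_exists:
  assumes "\<forall>y\<in>set xs. lt b x y" "xs = [] \<or> (\<exists>w. enc w xs)"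
  shows "\<exists>w. enc w (x # xs)"
proof (cases "xs = []")
  case True
  then show ?thesis by (intro exI[of _ "[]"]) simp
next
  case False
  then obtain w where "enc w xs" using assms by auto
  then show ?thesis using assms by (intro exI[of _ "b # w"]) simp
qed

lemma not_sorted_wrt_lt:
  assumes "distinct xs" "\<not> sorted_wrt (lt b) xs"
  obtains x y where "subseq [x, y] xs" "lt (\<not> b) x y"
proof -
  have "\<exists>x y. subseq [x, y] xs \<and> lt (\<not> b) x y"
    using assms
  proof (induction xs)
    case (Cons x xs)
    show ?case
    proof (cases "sorted_wrt (lt b) xs")
      case True
      then obtain y where y: "y \<in> set xs" "\<not> lt b x y" using Cons.prems by auto
      moreover have "x \<noteq> y" using y Cons.prems by auto
      ultimately show ?thesis
        by (intro exI[of _ x] exI[of _ y]) (auto simp: lt_def subseq_singleton_left)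
    next
      case False
      then show ?thesis using Cons by (metis distinct.simps(2) list_emb_Cons)
    qed
  qed simp
  then show ?thesis using that by blast
qed

text \<open>Rotated to start with 1, the permutation reads \<open>1 A n B\<close>. Avoidance puts
  \<open>A\<close> below \<open>B\<close> and makes each nonempty block encoded. If \<open>A\<close>
  increases, \<open>1 A n B\<close> is encoded; otherwise \<open>B\<close> decreases and
  \<open>n B 1 A\<close> is.\<close>

lemma circ_perm_avoiding_1342:
  assumes C: "C \<in> circ_perms n" and n: "n \<ge> 1" and av: "\<not> circ_contains C [1, 3, 4, 2]"
  obtains w where "length w = n - 1" "C = circ (sigma w)"
proof -
  obtain t where t: "C = circ t" "set t = {1..n}" "distinct t"
    using C by (auto simp: circ_perms_def permutations_of_set_def)
  then obtain l r where lr: "t = l @ 1 # r" using n by (metis atLeastAtMost_iff order_refl split_list)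
  define s where "s = 1 # r @ l"
  have Cs: "C = circ s" using circ_commute[of l "1 # r"] t(1) lr by (simp add: s_def)
  have s: "set s = {1..n}" "distinct s" using t lr by (auto simp: s_def)
  have "\<exists>w s'. enc w s' \<and> circ s' = C \<and> set s' = {1..n}"
  \<comment> \<open>The decomposition needs 1 and \<open>n\<close> to be different entries.\<close>
  proof (cases "n = 1")
    case True
    then have "set (r @ l) \<subseteq> {1}" "1 \<notin> set (r @ l)" using s by (auto simp: s_def)
    then have "set (r @ l) = {}" by (metis subset_singletonD singletonI)
    then have "enc [] s" by (simp add: s_def)
    with Cs s show ?thesis by blast
  next
    case False
    then have "n \<in> set (r @ l)" using s n unfolding s_def by (auto simp: set_eq_iff)
    then obtain A B where AB: "r @ l = A @ n # B" by (metis split_list)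
    have s_eq: "s = [1] @ A @ [n] @ B" using AB by (simp add: s_def)
    have bounds: "1 < x" "x < n" if "x \<in> set A \<union> set B" for x
    proof -
      have "x \<in> {1..n}" using that s(1) s_eq by auto
      moreover have "x \<noteq> 1" "x \<noteq> n" using that s(2) s_eq by auto
      ultimately show "1 < x" "x < n" by auto
    qed
    have sub: "subseq (us @ vs @ us' @ vs') s"
      if "subseq us [1]" "subseq vs A" "subseq us' [n]" "subseq vs' B" for us vs us' vs'
      unfolding s_eq using that by (intro list_emb_append_mono)
    \<comment> \<open>An occurrence of 1342 may wrap around the end of \<open>s\<close>:
      \<open>us\<close> is the part that stands first in \<open>s\<close> but last in the
      pattern.\<close>
    have no: False
      if "subseq (us @ vs) s" "vs @ us = [x, y, z, v]" "x < v" "v < y" "y < z" for us vs x y z v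
    proof -
      note rot = that(1,2)
      obtain u where "u \<in> C" "subseq [x, y, z, v] u"
        using rot(2) Cs subseq_rotate_circ[OF rot(1)] by auto
      moreover have "order_iso [x, y, z, v] [1, 3, 4, 2]"
        using that(3-5) by (auto simp: order_iso_zip)
      ultimately show False using av unfolding circ_contains_def by blast
    qed
    have less: "x < y" if "x \<in> set A" "y \<in> set B" for x y
    proof (rule ccontr)
      assume "\<not> x < y"
      moreover have "x \<noteq> y" using that s(2) s_eq by auto
      ultimately have "y < x" by simp
      moreover have "subseq ([] @ [1, x, n, y]) s"
        using sub[of "[1]" "[x]" "[n]" "[y]"] that by (simp add: subseq_singleton_left)
      ultimately show False using no[of "[]" "[1, x, n, y]"] bounds that by auto
    qed
    have A: "\<exists>w. enc w A" if "A \<noteq> []"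
    proof (rule enc_exists[OF that])
      show "distinct A" using s(2) s_eq by auto
      fix x y z assume xyz: "subseq [x, y, z] A"
      then have "set [x, y, z] \<subseteq> set A" by (rule subseq_imp_subset)
      then have "1 < z" "z < n" using bounds by auto
      \<comment> \<open>A 213 in \<open>A\<close> gives the occurrence \<open>y z n x\<close> after
        wrapping; a 231 gives \<open>1 x y z\<close>.\<close>
      then show "\<not> (y < x \<and> x < z) \<and> \<not> (z < x \<and> x < y)"
        using sub[of "[]" "[x, y, z]" "[n]" "[]"] no[of "[x]" "[y, z, n]" y z n x]
          sub[of "[1]" "[x, y, z]" "[]" "[]"] no[of "[]" "[1, x, y, z]"] xyz by auto
    qed
    have B: "\<exists>w. enc w B" if "B \<noteq> []"
    proof (rule enc_exists[OF that])
      show "distinct B" using s(2) s_eq by auto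
      fix x y z assume xyz: "subseq [x, y, z] B"
      then have "set [x, y, z] \<subseteq> set B" by (rule subseq_imp_subset)
      then have "1 < z" "z < n" using bounds by auto
      then show "\<not> (y < x \<and> x < z) \<and> \<not> (z < x \<and> x < y)"
        using sub[of "[]" "[]" "[n]" "[x, y, z]"] no[of "[n, x]" "[y, z]" y z n x]
          sub[of "[1]" "[]" "[]" "[x, y, z]"] no[of "[]" "[1, x, y, z]"] xyz by auto
    qed
    show ?thesis
    proof (cases "sorted_wrt (lt False) A")
      case True
      have "\<exists>w. enc w (n # B)"
        using bounds B by (intro enc_Cons_exists[where b = True]) (auto simp: lt_def)
      then obtain w where "enc w (n # B)" by blast
      with True have "enc (replicate (length A) False @ w) (A @ n # B)"
        using less bounds by (intro enc_append) (auto simp: lt_def)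
      then have "\<exists>w. enc w (1 # A @ n # B)"
        using bounds False n by (intro enc_Cons_exists[where b = False]) (auto simp: lt_def)
      then have "\<exists>w. enc w s" by (simp add: s_eq)
      with Cs s(1) show ?thesis by blast
    next
      case nA: False
      then obtain x y where xy: "subseq [x, y] A" "y < x"
        using not_sorted_wrt_lt[of A False] s(2) s_eq by (auto simp: lt_def)
      have sB: "sorted_wrt (lt True) B"
      proof (rule ccontr)
        assume "\<not> sorted_wrt (lt True) B"
        then obtain u v where uv: "subseq [u, v] B" "u < v"
          using not_sorted_wrt_lt[of B True] s(2) s_eq by (auto simp: lt_def)
        have "x < u" using less subseq_imp_subset[OF xy(1)] subseq_imp_subset[OF uv(1)] by auto
        then show False
          \<comment> \<open>A descent \<open>x y\<close> in \<open>A\<close> and an ascent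
            \<open>u v\<close> in \<open>B\<close> wrap to the occurrence \<open>y u v x\<close>, as
            \<open>A\<close> lies below \<open>B\<close>.\<close>
          using sub[of "[]" "[x, y]" "[]" "[u, v]"] no[of "[x]" "[y, u, v]" y u v x] xy uv by auto
      qed
      have "\<exists>w. enc w (1 # A)"
        using bounds A by (intro enc_Cons_exists[where b = False]) (auto simp: lt_def)
      then obtain w where "enc w (1 # A)" by blast
      with sB have "enc (replicate (length B) True @ w) (B @ 1 # A)"
        using less bounds by (intro enc_append) (auto simp: lt_def)
      then have "\<exists>w. enc w (n # B @ 1 # A)"
        using bounds False n by (intro enc_Cons_exists[where b = True]) (auto simp: lt_def)
      moreover have "circ (n # B @ 1 # A) = C"
        using circ_commute[of "1 # A" "n # B"] Cs s_eq by simp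
      moreover have "set (n # B @ 1 # A) = {1..n}" using s(1) s_eq by auto
      ultimately show ?thesis by blast
    qed
  qed
  then obtain w s' where w: "enc w s'" "circ s' = C" "set s' = {1..n}" by blast
  have "length s' = n" using w enc_distinct distinct_card by fastforce
  then have len: "length w = n - 1" using enc_length[OF w(1)] by simp
  have "s' = sigma w" using enc_unique[OF w(1) enc_sigma] set_sigma[of w] w(3) len n by simp
  then show ?thesis using that len w by blast
qed

section \<open>The unimodal patterns\<close>

abbreviation unimodal :: "nat \<Rightarrow> nat \<Rightarrow> nat list" where
  "unimodal a b \<equiv> sigma (replicate (a + 1) False @ replicate b True)"

lemma lt_simps: "lt False = (<)" "lt True = (>)"
  by (auto simp: lt_def fun_eq_iff)

lemma enc_increasing:
  assumes "\<forall>y\<in>set ys. a \<le> y" "enc w ys"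
  shows "enc (replicate (a - k) False @ w) ([k..<a] @ ys)"
proof -
  have "sorted_wrt (lt False) [k..<a]" by (simp add: lt_simps)
  from enc_append[OF this _ assms(2)] assms(1) show ?thesis by (force simp: lt_simps)
qed

lemma enc_decreasing:
  assumes "\<forall>y\<in>set ys. y < k" "enc w ys"
  shows "enc (replicate (a - k) True @ w) (rev [k..<a] @ ys)"
proof -
  have "sorted_wrt (lt True) (rev [k..<a])" by (simp add: lt_simps sorted_wrt_rev)
  from enc_append[OF this _ assms(2)] assms(1) show ?thesis by (force simp: lt_simps)
qed

text \<open>The zeros take 1 to \<open>a + 1\<close> and the ones take \<open>a + b + 2\<close> down
  to \<open>a + 3\<close>; the remaining value \<open>a + 2\<close> prolongs the decreasing
  run.\<close>

lemma unimodal_eq: "unimodal a b = [1..<a + 2] @ rev [a + 2..<a + b + 3]"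
proof -
  have r: "rev [a + 2..<a + b + 3] = rev [a + 3..<a + b + 3] @ [a + 2]"
    by (subst upt_conv_Cons) (auto simp: numeral_eq_Suc)
  have "enc (replicate b True @ []) (rev [a + 3..<a + b + 3] @ [a + 2])"
    using enc_decreasing[of "[a + 2]" "a + 3" "[]" "a + b + 3"] by simp
  then have "enc (replicate (a + 1) False @ replicate b True) ([1..<a + 2] @ rev [a + 2..<a + b + 3])"
    using enc_increasing[of "rev [a + 2..<a + b + 3]" "a + 2" "replicate b True" 1] r by simp
  then show ?thesis by (intro enc_unique[OF enc_sigma]) (auto simp: set_sigma)
qed

text \<open>With the decreasing run in front, \<open>a + 2\<close> gains the letter 1, while
  \<open>a + 1\<close> becomes the last entry and loses its letter 0.\<close>

lemma enc_unimodal_rotated: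
  "enc (replicate (b + 1) True @ replicate a False) (rev [a + 2..<a + b + 3] @ [1..<a + 2])"
proof -
  have "enc (replicate a False @ []) ([1..<a + 1] @ [a + 1])"
    using enc_increasing[of "[a + 1]" "a + 1" "[]" 1] by simp
  then have "enc (replicate a False) [1..<a + 2]" by simp
  from enc_decreasing[OF _ this, of "a + 2" "a + b + 3"] show ?thesis by (simp del: upt_Suc)
qed

lemma contains_unimodalI:
  assumes "enc w s"
    and "subseq (replicate (a + 1) False @ replicate b True) w \<or>
      subseq (replicate (b + 1) True @ replicate a False) w"
  shows "circ_contains (circ s) (unimodal a b)"
  using assms(2)
proof
  assume "subseq (replicate (a + 1) False @ replicate b True) w"
  then show ?thesis using circ_containsI[OF assms(1), of _ "[]" "unimodal a b"] enc_sigma by simp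
next
  assume "subseq (replicate (b + 1) True @ replicate a False) w"
  then show ?thesis unfolding unimodal_eq
    using circ_containsI[OF assms(1)] enc_unimodal_rotated by blast
qed

lemma word_append:
  assumes "xs \<noteq> []" "ys \<noteq> []"
  shows "word (xs @ ys) = word xs @ (hd ys < last xs) # word ys"
  using assms
proof (induction xs rule: word.induct)
  case ("2_2" x)
  then show ?case by (cases ys) auto
qed auto

text \<open>Up to rotation, the number of cyclic descents of a pattern is an invariant, and for a list
  encoded by a word it exceeds the number of ones by at most one.\<close>

lemma enc_rotate_count:
  assumes "enc (False # v) (P @ Q)" "enc u (Q @ P)"
  shows "count_list v True \<le> count_list u True" "count_list v False \<le> count_list u False"
proof -
  have "count_list v True \<le> count_list u True \<and> count_list v False \<le> count_list u False"
  proof (cases "P = [] \<or> Q = []")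
    case True
    then have "P @ Q = Q @ P" by auto
    then have "u = False # v" using enc_word assms by metis
    then show ?thesis by simp
  next
    case False
    then obtain x P' where P: "P = x # P'" by (cases P) auto
    \<comment> \<open>The leading 0 makes \<open>x\<close> the minimum, so the seam of
      \<open>Q @ P\<close> is a descent. This one compensates for the seam of \<open>P @ Q\<close>
      if that is a one; if it is a zero, the dropped leading 0 does.\<close>
    have "x < last Q" using assms(1) P False by (auto simp: lt_def)
    then have "u = word Q @ True # word P"
      using enc_word[OF assms(2)] False word_append[of Q P] P by simp
    moreover have "False # v = word P @ (hd Q < last P) # word Q"
      using enc_word[OF assms(1)] False word_append[of P Q] by simp
    then have "count_list (False # v) i = count_list (word P @ (hd Q < last P) # word Q) i" for i
      by simp
    from this[of True] this[of False] have
      "count_list v True \<le> count_list (word P) True + 1 + count_list (word Q) True"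
      "count_list v False \<le> count_list (word P) False + count_list (word Q) False"
      by (auto split: if_splits)
    ultimately show ?thesis by simp
  qed
  then show "count_list v True \<le> count_list u True" "count_list v False \<le> count_list u False"
    by auto
qed

lemma count_list_subseq: "subseq u w \<Longrightarrow> count_list u x \<le> count_list w x"
  by (induction rule: list_emb.induct) auto

lemma count_list_replicate: "count_list (replicate k x) y = (if x = y then k else 0)"
  by (induction k) auto

text \<open>Every encoded rotation of the pattern has at least \<open>b\<close> ones and
  \<open>a\<close> zeros, and \<open>w\<close> inherits them. The bound is not \<open>a + 1\<close>
  because a rotation may lose one zero.\<close>

lemma contains_unimodalD:
  assumes "enc w s" "circ_contains (circ s) (unimodal a b)"
  shows "b \<le> count_list w True" "a \<le> count_list w False"
proof -
  have "unimodal a b \<noteq> []" using enc_sigma enc_nonempty by blast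
  then obtain P Q u where *: "unimodal a b = P @ Q" "subseq u w" "enc u (Q @ P)"
    using circ_containsD[OF assms] by blast
  have "enc (False # (replicate a False @ replicate b True)) (P @ Q)"
    using enc_sigma[of "replicate (a + 1) False @ replicate b True"] *(1) by simp
  from enc_rotate_count[OF this *(3)] show "b \<le> count_list w True" "a \<le> count_list w False"
    using count_list_subseq[OF *(2)] by (auto simp: count_list_replicate intro: order_trans)
qed

lemma length_sigma: "length (sigma w) = length w + 1"
  using enc_length[OF enc_sigma] by simp

lemma circ_sigma_in_circ_perms: "circ (sigma w) \<in> circ_perms (length w + 1)"
  unfolding circ_perms_def
  by (intro imageI permutations_of_setI set_sigma enc_distinct[OF enc_sigma])

lemma finite_Av: "finite (Av n P)"
  by (simp add: Av_def circ_perms_def)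

section \<open>Counting\<close>

text \<open>Splitting by the first letter gives Pascal's recurrence.\<close>

lemma card_words_count:
  "card {w :: bool list. length w = N \<and> count_list w x = r} = N choose r"
proof (induction N arbitrary: r)
  case 0
  have "{w :: bool list. length w = 0 \<and> count_list w x = r} = (if r = 0 then {[]} else {})" by auto
  then show ?case by (cases r) auto
next
  case (Suc N)
  define W where "W N r = {w :: bool list. length w = N \<and> count_list w x = r}" for N r
  have fin: "finite (W N r)" for N r
    unfolding W_def by (rule finite_subset[OF _ finite_lists_length_eq[of "UNIV :: bool set" N]]) auto
  have inj: "inj_on (Cons y) X" for y :: bool and X by (auto intro: inj_onI)
  show ?case
  proof (cases r)
    case 0
    have "W (Suc N) 0 = Cons (\<not> x) ` W N 0"
      by (auto simp: W_def length_Suc_conv split: if_splits)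
    then show ?thesis using Suc[of 0] 0 by (simp add: W_def[symmetric] card_image inj)
  next
    case (Suc r')
    have "W (Suc N) r = Cons x ` W N r' \<union> Cons (\<not> x) ` W N r"
      by (auto simp: W_def length_Suc_conv Suc split: if_splits)
    moreover have "Cons x ` W N r' \<inter> Cons (\<not> x) ` W N r = {}" by auto
    ultimately have "card (W (Suc N) r) = card (W N r') + card (W N r)"
      by (simp add: card_Un_disjoint fin card_image inj)
    then show ?thesis using Suc.IH[of r'] Suc.IH[of r] Suc by (simp add: W_def)
  qed
qed

section \<open>Lower bound for the number of avoiders\<close>

lemma circ_inj:
  assumes "circ s = circ t" "distinct s" "hd s = hd t"
  shows "s = t"
proof -
  have "t \<in> circ s" using assms(1) self_in_circ by blast
  then obtain xs ys where "s = xs @ ys" "t = ys @ xs" by (rule circE)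
  with assms(2,3) show ?thesis by (cases xs; cases ys) auto
qed

text \<open>Words with only \<open>m - 1\<close> letters \<open>\<not> \<beta>\<close> miss the
  count that \<open>contains_unimodalD\<close> requires. Fixing the first letter as
  \<open>\<beta>\<close> fixes the first entry, so that distinct words give distinct circular
  permutations.\<close>

lemma card_Av_ge:
  assumes m: "m = (if \<beta> then a else b)" "m \<ge> 1"
  shows "N choose (m - 1) \<le> card (Av (N + 2) {[1, 3, 4, 2], unimodal a b})"
proof -
  define W where "W = {w :: bool list. length w = N \<and> count_list w (\<not> \<beta>) = m - 1}"
  define f where "f w = circ (sigma (\<beta> # w))" for w
  have inj: "inj_on f W"
  proof (rule inj_onI)
    fix v w assume vw: "v \<in> W" "w \<in> W" "f v = f w"
    obtain x xs y ys where s: "sigma (\<beta> # v) = x # xs" "sigma (\<beta> # w) = y # ys"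
      using enc_nonempty[OF enc_sigma] by (metis neq_Nil_conv)
    have e: "enc (\<beta> # v) (x # xs)" "enc (\<beta> # w) (y # ys)" using enc_sigma s by metis+
    have "set (x # xs) = set (y # ys)"
      using set_sigma[of "\<beta> # v"] set_sigma[of "\<beta> # w"] vw s by (simp add: W_def)
    have "x = y"
    proof (rule ccontr)
      assume "x \<noteq> y"
      then have "y \<in> set xs" "x \<in> set ys"
        using \<open>set (x # xs) = set (y # ys)\<close> by (metis list.set_intros(1) set_ConsD)+
      then have "lt \<beta> x y" "lt \<beta> y x" using e by auto
      then show False by (simp add: lt_def split: if_splits)
    qed
    moreover have "distinct (x # xs)" using e enc_distinct by blast
    ultimately have "x # xs = y # ys" using vw(3) s by (intro circ_inj) (simp_all add: f_def)
    then show "v = w" using e enc_word by (metis list.inject)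
  qed
  have "f w \<in> Av (N + 2) {[1, 3, 4, 2], unimodal a b}" if "w \<in> W" for w
  proof -
    have "f w \<in> circ_perms (N + 2)"
      using circ_sigma_in_circ_perms[of "\<beta> # w"] that by (simp add: f_def W_def)
    moreover have "\<not> circ_contains (f w) (unimodal a b)"
    proof
      assume "circ_contains (f w) (unimodal a b)"
      from contains_unimodalD[OF enc_sigma this[unfolded f_def]] show False
        using that m by (cases \<beta>) (auto simp: W_def)
    qed
    ultimately show ?thesis
      using enc_avoids_1342[OF enc_sigma] by (simp add: Av_def f_def)
  qed
  then have "card W \<le> card (Av (N + 2) {[1, 3, 4, 2], unimodal a b})"
    using inj finite_Av by (intro card_inj_on_le) auto
  then show ?thesis by (simp add: W_def card_words_count)
qed

section \<open>Upper bound for the number of avoiders\<close>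

lemma subseq_replicate_count: "k \<le> count_list w x \<Longrightarrow> subseq (replicate k x) w"
proof (induction w arbitrary: k)
  case (Cons y w)
  then show ?case using Cons.IH[of k] Cons.IH[of "k - 1"] by (cases k) (auto split: if_splits)
qed simp

lemma count_list_bool: "count_list w True + count_list w False = length w"
  by (induction w) auto

lemma finite_words: "finite {w :: bool list. length w = N}"
  using finite_lists_length_eq[of "UNIV :: bool set" N] by simp

text \<open>There are at most \<open>M\<close> admissible counts \<open>i\<close>, each at most
  \<open>M - 1\<close> and contributing \<open>N choose i \<le> N ^ (M - 1)\<close> words.\<close>

lemma card_words_few:
  assumes "k \<le> M" "N \<ge> 1"
  shows "card {w :: bool list. length w = N \<and> count_list w x < k} \<le> M * N ^ (M - 1)"
proof -
  have "{w :: bool list. length w = N \<and> count_list w x < k}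
      = (\<Union>i<k. {w. length w = N \<and> count_list w x = i})" by auto
  then have "card {w :: bool list. length w = N \<and> count_list w x < k}
      \<le> (\<Sum>i<k. card {w :: bool list. length w = N \<and> count_list w x = i})"
    by (simp add: card_UN_le)
  also have "\<dots> = (\<Sum>i<k. N choose i)" by (simp add: card_words_count)
  also have "\<dots> \<le> (\<Sum>i<k. N ^ (M - 1))"
  proof (rule sum_mono)
    fix i assume "i \<in> {..<k}"
    then have "N ^ i \<le> N ^ (M - 1)" using assms by (intro power_increasing) auto
    moreover have "N choose i \<le> N ^ i"
      by (cases "i \<le> N") (auto simp: binomial_le_pow binomial_eq_0)
    ultimately show "N choose i \<le> N ^ (M - 1)" by linarith
  qed
  also have "\<dots> \<le> M * N ^ (M - 1)" using assms by simp
  finally show ?thesis .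
qed

text \<open>Among the first \<open>c + d + 1\<close> letters there are \<open>c + 1\<close> zeros or \<open>d + 1\<close> ones, so the remaining
  letters contain fewer than \<open>d\<close> ones, respectively fewer than \<open>c\<close> zeros.\<close>

lemma card_Av_le:
  assumes "c \<le> M" "d \<le> M"
  obtains K where "\<And>N. N \<ge> 1 \<Longrightarrow>
    card (Av (c + d + 2 + N) {[1, 3, 4, 2], unimodal c d}) \<le> K * N ^ (M - 1)"
proof
  fix N :: nat assume N: "N \<ge> 1"
  define U where "U = {u :: bool list. length u = c + d + 1}"
  define V where "V x k = {v :: bool list. length v = N \<and> count_list v x < k}" for x k
  have finV: "finite (V x k)" for x k
    unfolding V_def by (rule finite_subset[OF _ finite_words[of N]]) auto
  have finU: "finite U" unfolding U_def by (rule finite_words)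
  \<comment> \<open>A word of length \<open>c + d + 1 + N\<close> splits into a prefix of fixed
    length, which only costs a constant factor, and a suffix of length \<open>N\<close> with few
    ones or few zeros.\<close>
  have "Av (c + d + 2 + N) {[1, 3, 4, 2], unimodal c d}
      \<subseteq> (\<lambda>(u, v). circ (sigma (u @ v))) ` (U \<times> (V True d \<union> V False c))"
  proof
    fix C assume "C \<in> Av (c + d + 2 + N) {[1, 3, 4, 2], unimodal c d}"
    then have C: "C \<in> circ_perms (c + d + 2 + N)" "\<not> circ_contains C [1, 3, 4, 2]"
      "\<not> circ_contains C (unimodal c d)" by (auto simp: Av_def)
    obtain w where w: "length w = c + d + 2 + N - 1" "C = circ (sigma w)"
      using circ_perm_avoiding_1342[OF C(1) _ C(2)] by auto
    have no: "\<not> subseq (replicate (c + 1) False @ replicate d True) w"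
      "\<not> subseq (replicate (d + 1) True @ replicate c False) w"
      using contains_unimodalI[OF enc_sigma] C(3) w by blast+
    define u where "u = take (c + d + 1) w"
    define v where "v = drop (c + d + 1) w"
    have uv: "w = u @ v" "length u = c + d + 1" "length v = N" using w by (auto simp: u_def v_def)
    \<comment> \<open>Letters \<open>x\<close> found in \<open>u\<close> followed by letters
      \<open>y\<close> found in \<open>v\<close> would form the forbidden subword.\<close>
    have split: "\<not> (i \<le> count_list u x \<and> j \<le> count_list v y)"
      if "\<not> subseq (replicate i x @ replicate j y) w" for i j x y
      using that uv(1) by (auto intro: list_emb_append_mono subseq_replicate_count)
    have "v \<in> V True d \<union> V False c"
      using split[OF no(1)] split[OF no(2)] count_list_bool[of u] uv by (auto simp: V_def)
    then show "C \<in> (\<lambda>(u, v). circ (sigma (u @ v))) ` (U \<times> (V True d \<union> V False c))"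
      using w uv by (intro image_eqI[of _ _ "(u, v)"]) (auto simp: U_def)
  qed
  then have "card (Av (c + d + 2 + N) {[1, 3, 4, 2], unimodal c d}) \<le> card (U \<times> (V True d \<union> V False c))"
    using finU finV by (intro surj_card_le) auto
  also have "\<dots> \<le> card U * (card (V True d) + card (V False c))"
    by (simp add: card_cartesian_product card_Un_le)
  also have "\<dots> \<le> card U * (M * N ^ (M - 1) + M * N ^ (M - 1))"
    unfolding V_def by (intro mult_left_mono add_mono card_words_few assms N) auto
  finally show "card (Av (c + d + 2 + N) {[1, 3, 4, 2], unimodal c d})
      \<le> (card {u :: bool list. length u = c + d + 1} * 2 * M) * N ^ (M - 1)"
    by (simp add: U_def algebra_simps)
qed

text \<open>The binomial grows with degree \<open>r\<close>, the left side with degree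
  \<open>M - 1 < r\<close>. A separate \<open>N'\<close> is allowed because the lower bound for
  avoiders is applied with a larger parameter than the upper bound.\<close>

lemma power_less_binomial:
  fixes K M r :: nat
  assumes "1 \<le> M" "M \<le> r"
  obtains N where "N \<ge> 1" "\<And>N'. N \<le> N' \<Longrightarrow> K * N ^ (M - 1) < N' choose r"
proof
  \<comment> \<open>The choice gives \<open>K * r ^ r < N\<close>, which absorbs the constants, and
    \<open>r \<le> N\<close>, which validates \<open>(N' / r) ^ r \<le> N' choose r\<close>.\<close>
  define N where "N = K * r ^ r + r"
  show "N \<ge> 1" using assms by (simp add: N_def)
  fix N' assume N': "N \<le> N'"
  have "real (K * N ^ (M - 1)) * real r ^ r = real (K * r ^ r * N ^ (M - 1))" by simp
  also have "K * r ^ r * N ^ (M - 1) \<le> K * r ^ r * N ^ (r - 1)"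
    using assms \<open>N \<ge> 1\<close> by (intro mult_left_mono power_increasing) auto
  also have "K * r ^ r * N ^ (r - 1) < N * N ^ (r - 1)"
    using assms \<open>N \<ge> 1\<close> by (intro mult_strict_right_mono) (auto simp: N_def)
  also have "N * N ^ (r - 1) = N ^ r" using assms by (cases r) auto
  also have "N ^ r \<le> N' ^ r" using N' by (rule power_mono) simp
  also have "real (N' ^ r) = (real N' / real r) ^ r * real r ^ r"
    using assms by (simp add: power_divide)
  also have "\<dots> \<le> real (N' choose r) * real r ^ r"
    using N' by (intro mult_right_mono binomial_ge_n_over_k_pow_k) (auto simp: N_def)
  finally have "real (K * N ^ (M - 1)) * real r ^ r < real (N' choose r) * real r ^ r" by simp
  then have "real (K * N ^ (M - 1)) < real (N' choose r)"
    by (rule mult_right_less_imp_less) simp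
  then show "K * N ^ (M - 1) < N' choose r" by (simp only: of_nat_less_iff)
qed

section \<open>Separating the classes\<close>

lemma not_wilf_equivalent_if_max_less:
  assumes sum: "a + b = c + d" and max: "max c d < max a b"
  shows "\<not> wilf_equivalent {[1, 3, 4, 2], unimodal a b} {[1, 3, 4, 2], unimodal c d}"
proof
  assume eq: "wilf_equivalent {[1, 3, 4, 2], unimodal a b} {[1, 3, 4, 2], unimodal c d}"
  define M where "M = max c d"
  define m where "m = max a b"
  \<comment> \<open>\<open>M = 0\<close> would force \<open>c = d = 0\<close>, hence
    \<open>a + b = 0\<close>, contradicting the strict inequality of the maxima.\<close>
  have M: "1 \<le> M" "M \<le> m - 1" "m \<ge> 1" using assms by (auto simp: M_def m_def)
  obtain K where K: "\<And>N. N \<ge> 1 \<Longrightarrow>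
      card (Av (c + d + 2 + N) {[1, 3, 4, 2], unimodal c d}) \<le> K * N ^ (M - 1)"
    using card_Av_le[of c M d] by (auto simp: M_def)
  obtain N where N: "N \<ge> 1" "\<And>N'. N \<le> N' \<Longrightarrow> K * N ^ (M - 1) < N' choose (m - 1)"
    using power_less_binomial[OF M(1,2)] by blast
  have "K * N ^ (M - 1) < (c + d + N) choose (m - 1)" by (intro N(2)) simp
  \<comment> \<open>\<open>\<beta>\<close> selects the larger of \<open>a\<close> and
    \<open>b\<close> as the parameter of the lower bound.\<close>
  also have "\<dots> \<le> card (Av (c + d + N + 2) {[1, 3, 4, 2], unimodal a b})"
    using M(3) by (intro card_Av_ge[where \<beta> = "b < a"]) (auto simp: m_def)
  also have "\<dots> = card (Av (c + d + 2 + N) {[1, 3, 4, 2], unimodal c d})"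
    using eq by (simp add: wilf_equivalent_def add_ac)
  finally show False using K[OF N(1)] by simp
qed

text \<open>At the size of the shorter pattern the longer one cannot occur, whereas the shorter one
  excludes its own circular class, which avoids 1342.\<close>

lemma not_wilf_equivalent_if_sum_less:
  assumes "a + b < c + d"
  shows "\<not> wilf_equivalent {[1, 3, 4, 2], unimodal a b} {[1, 3, 4, 2], unimodal c d}"
proof
  assume eq: "wilf_equivalent {[1, 3, 4, 2], unimodal a b} {[1, 3, 4, 2], unimodal c d}"
  define n where "n = a + b + 2"
  have long: "\<not> circ_contains C (unimodal c d)" if "C \<in> circ_perms n" for C
  proof
    assume "circ_contains C (unimodal c d)"
    then obtain s xs where "s \<in> C" "subseq xs s" "order_iso xs (unimodal c d)"
      by (auto simp: circ_contains_def)
    moreover have "length s = n"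
      using that \<open>s \<in> C\<close> by (auto simp: circ_perms_def circ_def dest: length_finite_permutations_of_set)
    ultimately show False
      using list_emb_length[of "(=)" xs s] assms by (auto simp: order_iso_def length_sigma n_def)
  qed
  let ?C = "circ (unimodal a b)"
  have "?C \<in> circ_perms n"
    using circ_sigma_in_circ_perms[of "replicate (a + 1) False @ replicate b True"] by (simp add: n_def)
  moreover have "circ_contains ?C (unimodal a b)"
    using contains_unimodalI[OF enc_sigma] by blast
  ultimately have "?C \<in> Av n {[1, 3, 4, 2], unimodal c d} - Av n {[1, 3, 4, 2], unimodal a b}"
    using enc_avoids_1342[OF enc_sigma] long by (auto simp: Av_def)
  moreover have "Av n {[1, 3, 4, 2], unimodal a b} \<subseteq> Av n {[1, 3, 4, 2], unimodal c d}"
    using long by (auto simp: Av_def)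
  ultimately have "Av n {[1, 3, 4, 2], unimodal a b} \<subset> Av n {[1, 3, 4, 2], unimodal c d}" by blast
  then have "card (Av n {[1, 3, 4, 2], unimodal a b}) < card (Av n {[1, 3, 4, 2], unimodal c d})"
    by (intro psubset_card_mono finite_Av)
  then show False using eq by (auto simp: wilf_equivalent_def n_def)
qed

lemma wilf_equivalent_sym: "wilf_equivalent P Q \<Longrightarrow> wilf_equivalent Q P"
  by (simp add: wilf_equivalent_def)

theorem theorem3p18:
  fixes a b c d :: nat
  assumes "{a, b} \<noteq> {c, d}"
  shows "\<not> wilf_equivalent
     {[1, 3, 4, 2], sigma (replicate (a + 1) False @ replicate b True)}
     {[1, 3, 4, 2], sigma (replicate (c + 1) False @ replicate d True)}"
proof -
  consider "a + b < c + d" | "c + d < a + b" | "a + b = c + d" "max c d < max a b"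
    | "a + b = c + d" "max a b < max c d" | "a + b = c + d" "max a b = max c d" by linarith
  then show ?thesis
  proof cases
    case 5
    \<comment> \<open>Equal sums and equal maxima force equal minima.\<close>
    then have "a = c \<and> b = d \<or> a = d \<and> b = c" by (auto simp: max_def split: if_splits)
    with assms show ?thesis by auto
  qed (use not_wilf_equivalent_if_sum_less not_wilf_equivalent_if_max_less wilf_equivalent_sym in metis)+
qed

end
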